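(* Let $\mathbf K\in\mathbb R^{m\times m}$ be a symmetric (indefinite) kernel matrix, $\mathbf y\in\mathbb R^m$, $\lambda>0$, $r>0$, and assume that $\frac1m\mathbf K^2+\lambda\mathbf K$ is indefinite (in particular there is $\alpha_0$ with $\alpha_0^\top(\frac1m\mathbf K^2+\lambda\mathbf K)\alpha_0<0$). Then the problem $$\operatorname*{argmin}_{\alpha\in\mathbb R^m:\ \alpha^\top\mathbf K^2\alpha\le mr^2}\Big\{\frac1m\|\mathbf K\alpha-\mathbf y\|_2^2+\lambda\,\alpha^\top\mathbf K\alpha\Big\}$$ is equivalent to the equality-constrained problem $$\operatorname*{argmin}_{\alpha\in\mathbb R^m:\ \alpha^\top\mathbf K^2\alpha= mr^2}\Big\{\frac1m\|\mathbf K\alpha-\mathbf y\|_2^2+\lambda\,\alpha^\top\mathbf K\alpha\Big\},$$ i.e. the two problems have the same solutions.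
   Context: $\mathbf K=[k(x_i,x_j)]_{i,j=1}^m$ is the kernel matrix of an indefinite kernel $k$ on sample points $x_1,\dots,x_m$, and $\mathbf y=[y_1,\dots,y_m]^\top$ is the vector of outputs. *)

theory Defs
  imports "HOL-Analysis.Analysis"
begin

definition kernel_matrix :: "('x \<Rightarrow> 'x \<Rightarrow> real) \<Rightarrow> ('m::finite \<Rightarrow> 'x) \<Rightarrow> real ^ 'm ^ 'm" where
  "kernel_matrix k x = (\<chi> i j. k (x i) (x j))"

definition psd_kernel :: "('x \<Rightarrow> 'x \<Rightarrow> real) \<Rightarrow> bool" where
  "psd_kernel k \<longleftrightarrow>
     (\<forall>(n::nat) (x :: nat \<Rightarrow> 'x) (c :: nat \<Rightarrow> real).
        0 \<le> (\<Sum>i<n. \<Sum>j<n. c i * c j * k (x i) (x j)))"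

(* As usual in indefinite kernel learning, a kernel is called indefinite as soon as it fails to be
   positive semidefinite; unlike for matrices below, it is not required to take both signs. *)
definition indefinite_kernel :: "('x \<Rightarrow> 'x \<Rightarrow> real) \<Rightarrow> bool" where
  "indefinite_kernel k \<longleftrightarrow> (\<forall>s t. k s t = k t s) \<and> \<not> psd_kernel k"

definition indefinite :: "real ^ 'm ^ 'm \<Rightarrow> bool" where
  "indefinite A \<longleftrightarrow> (\<exists>v. v \<bullet> (A *v v) < 0) \<and> (\<exists>w. w \<bullet> (A *v w) > 0)"

definition objective ::
    "real ^ 'm ^ 'm \<Rightarrow> real ^ 'm \<Rightarrow> real \<Rightarrow> real ^ 'm \<Rightarrow> real" where
  "objective K y lam \<alpha> =
     1 / real CARD('m) * (norm (K *v \<alpha> - y))\<^sup>2 + lam * (\<alpha> \<bullet> (K *v \<alpha>))"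

definition argmin_set :: "('a \<Rightarrow> bool) \<Rightarrow> ('a \<Rightarrow> real) \<Rightarrow> 'a set" where
  "argmin_set P f = {a. is_arg_min f P a}"

end

theory Submission
  imports Defs "HOL-Library.Quadratic_Discriminant"
begin

text \<open>Along a direction of negative curvature of the quadratic part the objective is strictly concave,
  whereas the constraint function is a convex quadratic with positive leading coefficient, because
  such a direction cannot lie in the null space of \<open>K\<close>.  Hence a line through an interior point leaves the
  feasible set on both sides, and the objective is strictly smaller at one of the two exit points.\<close>

lemma pos_root_quadratic:
  fixes a b c :: real
  assumes "a > 0" "c < 0"
  obtains t where "t > 0" "a * t\<^sup>2 + b * t + c = 0"
proof
  \<comment> \<open>The larger root. As \<open>a * c < 0\<close>, the discriminant exceeds
    \<open>b\<^sup>2\<close>, so its square root outweighs \<open>- b\<close> whatever the sign of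
    \<open>b\<close>.\<close>
  define t where "t = (- b + sqrt (discrim a b c)) / (2 * a)"
  have "a * c < 0"
    using assms by (simp add: mult_pos_neg)
  then have "b\<^sup>2 < discrim a b c"
    by (simp add: discrim_def)
  then have "sqrt (discrim a b c) > \<bar>b\<bar>"
    by (metis real_sqrt_abs real_sqrt_less_iff)
  then show "t > 0"
    using assms(1) by (simp add: t_def)
  have "discrim a b c \<ge> 0"
    using \<open>b\<^sup>2 < discrim a b c\<close> by (smt (verit) zero_le_power2)
  then show "a * t\<^sup>2 + b * t + c = 0"
    using discriminant_iff[of a t b c] assms(1) t_def by auto
qed

text \<open>A minimiser over \<open>P\<close> must satisfy \<open>Q\<close>, or some
  \<open>b\<close> would beat it. Conversely, a point of \<open>P\<close> that beats a minimiser
  over \<open>Q\<close> either satisfies \<open>Q\<close> or is beaten by a point that does. Both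
  sets may be empty.\<close>

lemma argmin_set_eqI:
  fixes f :: "'a \<Rightarrow> real"
  assumes "\<And>a. Q a \<Longrightarrow> P a"
    and "\<And>a. P a \<Longrightarrow> \<not> Q a \<Longrightarrow> \<exists>b. Q b \<and> f b < f a"
  shows "argmin_set P f = argmin_set Q f"
  unfolding argmin_set_def is_arg_min_def using assms by (blast intro: less_trans)

lemma power2_norm_add_scaleR:
  fixes a b :: "'a::real_inner"
  shows "(norm (a + t *\<^sub>R b))\<^sup>2 = (norm a)\<^sup>2 + 2 * t * (a \<bullet> b) + t\<^sup>2 * (norm b)\<^sup>2"
  unfolding power2_norm_eq_inner
  by (simp add: inner_add_left inner_add_right inner_commute algebra_simps power2_eq_square)

lemma inner_transpose_mult_self:
  fixes K :: "real ^ 'n::finite ^ 'm::finite"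
  shows "d \<bullet> ((transpose K ** K) *v d) = (norm (K *v d))\<^sup>2"
  by (metis dot_lmul_matrix inner_commute matrix_vector_mul_assoc power2_norm_eq_inner
      transpose_matrix_vector)

text \<open>The curvature along \<open>d\<close> depends on neither \<alpha> nor \<open>y\<close>.
  With \<open>transpose K ** K\<close> and both cross terms kept, the expansion holds for every
  square \<open>K\<close>.\<close>

lemma objective_add_scaleR:
  fixes K :: "real ^ 'm::finite ^ 'm"
  shows "objective K y lam (\<alpha> + t *\<^sub>R d) = objective K y lam \<alpha>
    + t\<^sup>2 * (d \<bullet> (((1 / real CARD('m)) *\<^sub>R (transpose K ** K) + lam *\<^sub>R K) *v d))
    + t * (2 / real CARD('m) * ((K *v \<alpha> - y) \<bullet> (K *v d)) + lam * (\<alpha> \<bullet> (K *v d) + d \<bullet> (K *v \<alpha>)))"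
proof -
  have "K *v (\<alpha> + t *\<^sub>R d) - y = (K *v \<alpha> - y) + t *\<^sub>R (K *v d)"
    by (simp add: matrix_vector_right_distrib matrix_vector_mult_scaleR)
  moreover have "(\<alpha> + t *\<^sub>R d) \<bullet> (K *v (\<alpha> + t *\<^sub>R d))
      = \<alpha> \<bullet> (K *v \<alpha>) + t * (\<alpha> \<bullet> (K *v d) + d \<bullet> (K *v \<alpha>)) + t\<^sup>2 * (d \<bullet> (K *v d))"
    by (simp add: matrix_vector_right_distrib matrix_vector_mult_scaleR inner_add_left
        inner_add_right algebra_simps power2_eq_square)
  moreover have "d \<bullet> (((1 / real CARD('m)) *\<^sub>R (transpose K ** K) + lam *\<^sub>R K) *v d)
      = 1 / real CARD('m) * (norm (K *v d))\<^sup>2 + lam * (d \<bullet> (K *v d))"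
    by (simp add: matrix_vector_mult_add_rdistrib scaleR_matrix_vector_assoc[symmetric]
        inner_add_right inner_transpose_mult_self)
  ultimately show ?thesis
    by (simp only: objective_def power2_norm_add_scaleR) (simp add: field_simps)
qed

lemma exists_boundary_point_objective_less:
  fixes K :: "real ^ 'm::finite ^ 'm"
  assumes neg: "v \<bullet> (((1 / real CARD('m)) *\<^sub>R (transpose K ** K) + lam *\<^sub>R K) *v v) < 0"
    and int: "(norm (K *v \<alpha>))\<^sup>2 < R"
  shows "\<exists>\<beta>. (norm (K *v \<beta>))\<^sup>2 = R \<and> objective K y lam \<beta> < objective K y lam \<alpha>"
proof -
  define M where "M = (1 / real CARD('m)) *\<^sub>R (transpose K ** K) + lam *\<^sub>R K"
  define s where "s = (\<lambda>d. 2 / real CARD('m) * ((K *v \<alpha> - y) \<bullet> (K *v d))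
    + lam * (\<alpha> \<bullet> (K *v d) + d \<bullet> (K *v \<alpha>)))"
  \<comment> \<open>The slope \<open>s\<close> is odd in the direction and the curvature even, so a
    change of sign gives a nonpositive slope at no cost, and a positive step suffices.\<close>
  define d where "d = (if s v \<le> 0 then v else - v)"
  \<comment> \<open>Stated for any matrix, as it is applied to \<open>M\<close> too.\<close>
  have K_uminus: "K *v (- v) = - (K *v v)" for K :: "real ^ 'm ^ 'm"
    using matrix_vector_mult_scaleR[of K "-1" v] by simp
  have "s (- v) = - s v"
    by (simp add: s_def K_uminus algebra_simps)
  then have sd: "s d \<le> 0"
    by (simp add: d_def)
  have Md: "d \<bullet> (M *v d) < 0"
    using neg by (simp add: d_def M_def[symmetric] K_uminus)
  \<comment> \<open>If \<open>K *v d\<close> were zero, both summands of the form in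
    \<open>Md\<close> would vanish.\<close>
  have "K *v d \<noteq> 0"
    using Md by (auto simp: M_def matrix_vector_mult_add_rdistrib
        scaleR_matrix_vector_assoc[symmetric] matrix_vector_mul_assoc[symmetric])
  \<comment> \<open>This is the boundary condition at \<open>\<alpha> + t *\<^sub>R d\<close>,
    expanded in \<open>t\<close>; its constant term is negative by \<open>int\<close>.\<close>
  then obtain t where t: "t > 0"
    "(norm (K *v d))\<^sup>2 * t\<^sup>2 + 2 * ((K *v \<alpha>) \<bullet> (K *v d)) * t + ((norm (K *v \<alpha>))\<^sup>2 - R) = 0"
    using pos_root_quadratic[of "(norm (K *v d))\<^sup>2" "(norm (K *v \<alpha>))\<^sup>2 - R"] int by auto
  have "(norm (K *v (\<alpha> + t *\<^sub>R d)))\<^sup>2 = R"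
    using t(2) by (simp add: matrix_vector_right_distrib matrix_vector_mult_scaleR
        power2_norm_add_scaleR algebra_simps)
  \<comment> \<open>Strictness comes from the curvature alone, since the slope may be zero.\<close>
  moreover have "t\<^sup>2 * (d \<bullet> (M *v d)) < 0" "t * s d \<le> 0"
    using t(1) Md sd by (simp_all add: mult_pos_neg mult_nonneg_nonpos)
  then have "objective K y lam (\<alpha> + t *\<^sub>R d) < objective K y lam \<alpha>"
    unfolding objective_add_scaleR M_def s_def by linarith
  ultimately show ?thesis
    by blast
qed

theorem proposition2:
  fixes k :: "'x \<Rightarrow> 'x \<Rightarrow> real"
    and x :: "'m::finite \<Rightarrow> 'x"
    and K :: "real ^ 'm ^ 'm"
    and y :: "real ^ 'm"
    and lam r :: real
  assumes "indefinite_kernel k"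
    and "K = kernel_matrix k x"
    and "lam > 0"
    and "r > 0"
    and "indefinite ((1 / real CARD('m)) *\<^sub>R (K ** K) + lam *\<^sub>R K)"
  shows "argmin_set (\<lambda>\<alpha>. \<alpha> \<bullet> ((K ** K) *v \<alpha>) \<le> real CARD('m) * r\<^sup>2) (objective K y lam) =
         argmin_set (\<lambda>\<alpha>. \<alpha> \<bullet> ((K ** K) *v \<alpha>) = real CARD('m) * r\<^sup>2) (objective K y lam)"
proof -
  \<comment> \<open>The matrix inherits its symmetry from the kernel.\<close>
  have sym: "transpose K = K"
    using assms(1,2) by (simp add: transpose_def kernel_matrix_def indefinite_kernel_def vec_eq_iff)
  have form: "\<alpha> \<bullet> ((K ** K) *v \<alpha>) = (norm (K *v \<alpha>))\<^sup>2" for \<alpha>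
    using inner_transpose_mult_self[of \<alpha> K] by (simp add: sym)
  obtain v where "v \<bullet> (((1 / real CARD('m)) *\<^sub>R (transpose K ** K) + lam *\<^sub>R K) *v v) < 0"
    using assms(5) by (auto simp: indefinite_def sym)
  from exists_boundary_point_objective_less[OF this] show ?thesis
    unfolding form by (intro argmin_set_eqI) auto
qed

end
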